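(* Let $f_i:\mathbb{R}^n\to\mathbb{R}$, $i=1,\dots,m$, be convex and twice continuously differentiable, and suppose that $f=\sum_{i=1}^mf_i$ is strongly convex with constant $c>0$, i.e. $f(x)-\frac c2\|x\|^2$ is convex on $\mathbb{R}^n$. Let $x^*$ be the unique minimizer of $f$. Suppose that the iterates $\{x_1^k,x_2^k,\dots,x_m^k\}_{k\ge1}$ of the incremental gradient (IG) method considered below are uniformly bounded, i.e. there is a non-empty compact Euclidean ball $\mathcal{X}\subset\mathbb{R}^n$ that contains all of them. Let $G$ be a constant with $\max_{1\le i\le m}\sup_{x\in\mathcal{X}}\|\nabla f_i(x)\|\le G$, let $L_i=\max_{z\in\mathcal{X}}\|\nabla^2f_i(z)\|$, $L=\sum_{i=1}^mL_i$, and $\widetilde M=LGm$. Let $\varepsilon<2\widetilde M/c^2$ be a given positive number. Then IG with constant stepsize $\alpha=\varepsilon c/(2\widetilde M)$ requires at most $$O\!\left(\frac{\widetilde M}{c^2}\,\frac{\log(1/\varepsilon)}{\varepsilon}\right)$$ cycles to guarantee convergence to an $\varepsilon$-neighborhood of the optimal solution $x^*$.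
   Context: The IG method for minimizing $f=\sum_{i=1}^mf_i$ with constant stepsize $\alpha>0$: from an initial point $x_1^1\in\mathbb{R}^n$, for each $k\ge1$ set $x_{i+1}^k=x_i^k-\alpha\nabla f_i(x_i^k)$ for $i=1,\dots,m$, and $x_1^{k+1}=x_{m+1}^k$. One cycle is the passage from $x_1^k$ to $x_1^{k+1}$. The $\varepsilon$-neighborhood of $x^*$ is $\{x\in\mathbb{R}^n:\|x-x^*\|\le\varepsilon\}$. The norm $\|\cdot\|$ is the Euclidean norm for vectors and the spectral norm for matrices. *)

theory Defs
  imports "HOL-Analysis.Analysis"
begin

definition grad :: "(real^'n \<Rightarrow> real) \<Rightarrow> real^'n \<Rightarrow> real^'n" where
  "grad f x = (THE D. GDERIV f x :> D)"

definition hessian :: "(real^'n \<Rightarrow> real) \<Rightarrow> real^'n \<Rightarrow> real^'n^'n" where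
  "hessian f x = jacobian (grad f) (at x)"

definition spectral_norm :: "real^'n^'n \<Rightarrow> real" where
  "spectral_norm A = onorm ((*v) A)"

text \<open>Continuity of f and of its gradient is implied by the differentiability requirements.
  These also make the description operators in \<open>grad\<close> and \<open>hessian\<close> denote genuine derivatives.\<close>

definition twice_continuously_differentiable :: "(real^'n \<Rightarrow> real) \<Rightarrow> bool" where
  "twice_continuously_differentiable f \<longleftrightarrow>
     (\<forall>x. f differentiable at x) \<and> (\<forall>x. grad f differentiable at x) \<and>
     continuous_on UNIV (hessian f)"

definition strongly_convex :: "real \<Rightarrow> (real^'n \<Rightarrow> real) \<Rightarrow> bool" where
  "strongly_convex c f \<longleftrightarrow> c > 0 \<and> convex_on UNIV (\<lambda>x. f x - c / 2 * (norm x)\<^sup>2)"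

text \<open>The supremum is a maximum when f is twice continuously differentiable and X is nonempty
  and compact.\<close>

definition hessian_bound :: "(real^'n \<Rightarrow> real) \<Rightarrow> (real^'n) set \<Rightarrow> real" where
  "hessian_bound f X = (SUP z\<in>X. spectral_norm (hessian f z))"

text \<open>The components are \<open>f 1, \<dots>, f m\<close>, and \<open>x k i\<close> is the iterate with cycle index k (from 1) and inner
  index i (from 1 to m + 1). Other values of f and x are irrelevant. The starting point is \<open>x 1 1\<close>;
  after N cycles the method has reached \<open>x (N + 1) 1\<close>.\<close>

definition IG_iterates ::
  "nat \<Rightarrow> (nat \<Rightarrow> real^'n \<Rightarrow> real) \<Rightarrow> real \<Rightarrow> (nat \<Rightarrow> nat \<Rightarrow> real^'n) \<Rightarrow> bool" where
  "IG_iterates m f \<alpha> x \<longleftrightarrow>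
     (\<forall>k\<ge>1. (\<forall>i\<in>{1..m}. x k (i + 1) = x k i - \<alpha> *\<^sub>R grad (f i) (x k i)) \<and>
            x (k + 1) 1 = x k (m + 1))"

text \<open>The order bound in the theorem based on this theory is read as \<open>\<epsilon> \<rightarrow> 0\<close> (for \<open>\<epsilon> \<ge> 1\<close> the logarithm is not positive). A bound
  \<open>O(M/c\<^sup>2 \<cdot> log(1/\<epsilon>)/\<epsilon>)\<close> with \<open>M\<close> and \<open>c\<close> displayed is uniform in the problem data: the constant C
  depends on none of them, and the threshold for \<open>\<epsilon>\<close> only on a bound R for the distance of the
  starting point from the minimizer.\<close>

end

theory Submission
  imports Defs
begin

text \<open>
  Let \<open>d\<^sub>k\<close> be the distance of the starting point of cycle \<open>k\<close> from the minimizer, \<open>t = \<alpha> c\<close>, and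
  \<open>g\<^sub>k\<close> the gradient of \<open>F\<close> at that starting point. One cycle is a gradient step for \<open>F\<close> with an error:
  inside a cycle the iterates drift by at most \<open>\<alpha> G m\<close>, so replacing all inner gradients by gradients at
  the starting point changes their sum by at most \<open>\<alpha> L G m = \<alpha> M\<close> (lemma \<open>cycle_as_inexact_step\<close>).

  The obvious way to continue, contraction of an exact gradient step towards the minimizer, needs a
  bound for the Hessians between the iterates and the minimizer. The minimizer may lie outside \<open>X\<close>,
  where nothing bounds them. Instead, three strong convexity inequalities are added: two compare the
  endpoints of the step with the minimizer and use no smoothness, and only the third, between the
  endpoints, uses that the gradient is \<open>L\<close>-Lipschitz on \<open>X\<close>. If \<open>\<alpha> L \<le> 1/2\<close> this gives
  \<open>(1 + t) d\<^sub>k\<^sub>+\<^sub>1\<^sup>2 \<le> (1 - t) d\<^sub>k\<^sup>2 + 2 \<alpha>\<^sup>2 M d\<^sub>k\<^sub>+\<^sub>1\<close> (lemma \<open>inexact_gradient_step\<close>). By the choice of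
  \<open>\<alpha>\<close> the last term is \<open>t \<epsilon> d\<^sub>k\<^sub>+\<^sub>1 \<le> t (d\<^sub>k\<^sub>+\<^sub>1\<^sup>2 + \<epsilon>\<^sup>2/4)\<close>, hence
  \<open>d\<^sub>k\<^sub>+\<^sub>1\<^sup>2 \<le> (1 - t) d\<^sub>k\<^sup>2 + t \<epsilon>\<^sup>2/4\<close>. The excess of \<open>d\<^sub>k\<^sup>2\<close> over \<open>\<epsilon>\<^sup>2/4\<close> therefore decays like
  \<open>(1 - t)\<^sup>k\<close>, and \<open>log (2 d\<^sub>1\<^sup>2/\<epsilon>\<^sup>2) / t\<close> cycles suffice, where \<open>1/t = 2 M / (c\<^sup>2 \<epsilon>)\<close>.

  If \<open>\<alpha> L > 1/2\<close>, then \<open>\<epsilon> = 2 \<alpha> L G m / c > G m / c\<close>. Since the gradient of \<open>F\<close> is at most \<open>G m\<close>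
  on \<open>X\<close>, strong convexity puts every point of \<open>X\<close> within \<open>G m / c\<close> of the minimizer, so no cycle is
  needed.
\<close>

section \<open>Gradients of convex and strongly convex functions\<close>

lemma GDERIV_grad:
  fixes f :: "real^'n \<Rightarrow> real"
  assumes "f differentiable at x"
  shows "GDERIV f x :> grad f x"
proof -
  obtain f' where f': "(f has_derivative f') (at x)"
    using assms by (auto simp: differentiable_def)
  have lin: "linear f'"
    using f' by (rule has_derivative_linear)
  have "f' = (\<lambda>h. h \<bullet> adjoint f' 1)"
    using adjoint_works[OF lin, of _ 1] by auto
  then have "GDERIV f x :> adjoint f' 1"
    using f' unfolding gderiv_def by simp
  moreover have "E = D" if "GDERIV f x :> D" "GDERIV f x :> E" for D E
  proof -
    have "(\<lambda>h. h \<bullet> D) = (\<lambda>h. h \<bullet> E)"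
      using that unfolding gderiv_def by (rule has_derivative_unique)
    then show ?thesis
      by (metis vector_eq_ldot)
  qed
  ultimately show ?thesis
    unfolding grad_def by (metis the_equality)
qed

lemma GDERIV_sum:
  assumes "\<And>i. i \<in> I \<Longrightarrow> GDERIV (f i) x :> D i"
  shows "GDERIV (\<lambda>y. \<Sum>i\<in>I. f i y) x :> (\<Sum>i\<in>I. D i)"
  using assms unfolding gderiv_def by (auto simp: inner_sum_right intro!: has_derivative_sum)

text \<open>Restricting to the line through \<open>x\<close> and \<open>y\<close> reduces this to the one-dimensional case.\<close>

lemma convex_on_ge_tangent:
  fixes h :: "'a::real_inner \<Rightarrow> real"
  assumes "convex_on UNIV h" "GDERIV h x :> D"
  shows "h x + (y - x) \<bullet> D \<le> h y"
proof -
  define p where "p = (\<lambda>s. h (x + s *\<^sub>R (y - x)))"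
  have "convex_on UNIV p"
  proof (rule convex_onI)
    fix u a b :: real
    assume u: "0 < u" "u < 1"
    have "x + ((1 - u) *\<^sub>R a + u *\<^sub>R b) *\<^sub>R (y - x)
        = (1 - u) *\<^sub>R (x + a *\<^sub>R (y - x)) + u *\<^sub>R (x + b *\<^sub>R (y - x))"
      by (simp add: algebra_simps)
    then show "p ((1 - u) *\<^sub>R a + u *\<^sub>R b) \<le> (1 - u) * p a + u * p b"
      unfolding p_def using convex_onD[OF assms(1), of u] u by simp
  qed simp
  moreover have "(p has_real_derivative (y - x) \<bullet> D) (at 0)"
  proof -
    have "(h has_derivative (\<lambda>v. v \<bullet> D)) (at (x + 0 *\<^sub>R (y - x)))"
      using assms(2) by (simp add: gderiv_def)
    moreover have "((\<lambda>s::real. x + s *\<^sub>R (y - x)) has_derivative (\<lambda>s. s *\<^sub>R (y - x))) (at 0)"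
      by (auto intro!: derivative_eq_intros)
    ultimately have "(p has_derivative (\<lambda>s. (s *\<^sub>R (y - x)) \<bullet> D)) (at 0)"
      unfolding p_def by (rule has_derivative_compose[rotated])
    then show ?thesis
      by (simp add: has_field_derivative_def mult.commute[of _ "(y - x) \<bullet> D"] mult_commute_abs)
  qed
  ultimately have "p 1 - p 0 \<ge> ((y - x) \<bullet> D) * (1 - 0)"
    by (intro convex_on_imp_above_tangent[where A = UNIV]) auto
  then show ?thesis
    by (simp add: p_def)
qed

text \<open>This is the tangent inequality for \<open>F x - c/2 \<parallel>x\<parallel>\<^sup>2\<close>; completing the square turns the two
  squared norms into \<open>\<parallel>y - x\<parallel>\<^sup>2\<close>.\<close>

lemma strongly_convex_ge_tangent:
  assumes "strongly_convex c F" "GDERIV F x :> D"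
  shows "F x + (y - x) \<bullet> D + c / 2 * (norm (y - x))\<^sup>2 \<le> F y"
proof -
  define h where "h = (\<lambda>x. F x - c / 2 * (norm x)\<^sup>2)"
  have "convex_on UNIV h"
    using assms(1) by (simp add: strongly_convex_def h_def)
  moreover have "GDERIV h x :> D - c *\<^sub>R x"
    using assms(2) unfolding gderiv_def h_def power2_norm_eq_inner
    by (auto intro!: derivative_eq_intros simp: inner_diff_right inner_commute)
  ultimately have "h x + (y - x) \<bullet> (D - c *\<^sub>R x) \<le> h y"
    by (rule convex_on_ge_tangent)
  then show ?thesis
    by (simp add: h_def power2_norm_eq_inner inner_simps inner_commute algebra_simps)
qed

lemma GDERIV_arg_min_eq_0:
  assumes "is_arg_min F (\<lambda>_. True) xs" "GDERIV F xs :> D"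
  shows "D = 0"
proof -
  have "(\<lambda>v. v \<bullet> D) = (\<lambda>v. 0)"
    using assms unfolding gderiv_def
    by (intro differential_zero_maxmin[of xs UNIV F]) (auto simp: is_arg_min_linorder)
  then have "D \<bullet> D = 0"
    by metis
  then show ?thesis
    by simp
qed

lemma strongly_convex_quadratic_growth:
  assumes "strongly_convex c F" "is_arg_min F (\<lambda>_. True) xs" "GDERIV F xs :> D"
  shows "F xs + c / 2 * (norm (y - xs))\<^sup>2 \<le> F y"
  using strongly_convex_ge_tangent[OF assms(1,3), of y] GDERIV_arg_min_eq_0[OF assms(2,3)] by simp

text \<open>Adding the growth inequality and the tangent inequality at \<open>y\<close> leaves
  \<open>c \<parallel>y - xs\<parallel>\<^sup>2 \<le> (y - xs) \<bullet> D\<close>.\<close>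

lemma strongly_convex_dist_arg_min_le:
  assumes "strongly_convex c F" "is_arg_min F (\<lambda>_. True) xs" "GDERIV F xs :> D'" "GDERIV F y :> D"
  shows "c * norm (y - xs) \<le> norm D"
proof -
  have "F xs + c / 2 * (norm (y - xs))\<^sup>2 \<le> F y"
    using assms(1-3) by (rule strongly_convex_quadratic_growth)
  moreover have "F y + (xs - y) \<bullet> D + c / 2 * (norm (xs - y))\<^sup>2 \<le> F xs"
    using assms(1,4) by (rule strongly_convex_ge_tangent)
  ultimately have "c * (norm (y - xs))\<^sup>2 \<le> (y - xs) \<bullet> D"
    by (simp add: norm_minus_commute inner_diff_left)
  also have "\<dots> \<le> norm (y - xs) * norm D"
    by (rule norm_cauchy_schwarz)
  finally have "norm (y - xs) * (c * norm (y - xs)) \<le> norm (y - xs) * norm D"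
    by (simp add: power2_eq_square mult_ac)
  then show ?thesis
    by (cases "norm (y - xs) = 0") (auto simp: mult_le_cancel_left)
qed

section \<open>The Hessian bound as a Lipschitz constant of the gradient\<close>

text \<open>Compactness matters here because the supremum of an unbounded set of reals bounds nothing.\<close>

lemma spectral_norm_hessian_le:
  fixes f :: "real^'n \<Rightarrow> real"
  assumes "continuous_on X (hessian f)" "compact X" "z \<in> X"
  shows "spectral_norm (hessian f z) \<le> hessian_bound f X"
proof -
  have "bounded (hessian f ` X)"
    using assms by (intro compact_imp_bounded compact_continuous_image)
  then obtain B where B: "\<And>z. z \<in> X \<Longrightarrow> norm (hessian f z) \<le> B"
    by (auto simp: bounded_iff)
  have "spectral_norm (hessian f z) \<le> real CARD('n) * real CARD('n) * B" if "z \<in> X" for z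
    unfolding spectral_norm_def
  proof (rule onorm_le_matrix_component)
    fix i j
    have "\<bar>hessian f z $ i $ j\<bar> \<le> norm (hessian f z)"
      by (meson component_le_norm_cart Finite_Cartesian_Product.norm_nth_le order_trans)
    also have "\<dots> \<le> B"
      by (rule B) fact
    finally show "\<bar>hessian f z $ i $ j\<bar> \<le> B" .
  qed
  then have "bdd_above ((\<lambda>z. spectral_norm (hessian f z)) ` X)"
    by (intro bdd_aboveI2)
  then show ?thesis
    unfolding hessian_bound_def using assms(3) by (intro cSUP_upper)
qed

lemma hessian_bound_nonneg:
  fixes f :: "real^'n \<Rightarrow> real"
  assumes "continuous_on X (hessian f)" "compact X" "X \<noteq> {}"
  shows "0 \<le> hessian_bound f X"
proof -
  obtain z where z: "z \<in> X"
    using assms(3) by blast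
  have "0 \<le> spectral_norm (hessian f z)"
    unfolding spectral_norm_def by (intro onorm_pos_le matrix_vector_mul_bounded_linear)
  then show ?thesis
    using spectral_norm_hessian_le[OF assms(1,2) z] by linarith
qed

lemma grad_lipschitz:
  fixes f :: "real^'n \<Rightarrow> real"
  assumes "twice_continuously_differentiable f" "compact X" "convex X" "y \<in> X" "z \<in> X"
  shows "norm (grad f y - grad f z) \<le> hessian_bound f X * norm (y - z)"
proof (rule differentiable_bound[OF assms(3)])
  fix w assume w: "w \<in> X"
  have "(grad f has_derivative (*v) (hessian f w)) (at w)"
    using assms(1) unfolding twice_continuously_differentiable_def hessian_def
    by (simp add: jacobian_works[symmetric])
  then show "(grad f has_derivative (*v) (hessian f w)) (at w within X)"
    by (rule has_derivative_at_withinI)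
  have "continuous_on X (hessian f)"
    using assms(1) continuous_on_subset unfolding twice_continuously_differentiable_def by blast
  then show "onorm ((*v) (hessian f w)) \<le> hessian_bound f X"
    using spectral_norm_hessian_le[OF _ assms(2) w] by (simp add: spectral_norm_def)
qed (use assms in auto)

section \<open>One cycle of the incremental gradient method\<close>

text \<open>The error \<open>e\<close> collects the differences between the gradients at the start of the cycle and those
  at the inner iterates, which stay within \<open>\<alpha> G m\<close> of the start.\<close>

lemma cycle_as_inexact_step:
  fixes z :: "nat \<Rightarrow> 'a::real_normed_vector" and g :: "nat \<Rightarrow> 'a \<Rightarrow> 'a"
  assumes step: "\<And>i. i \<in> {1..m} \<Longrightarrow> z (i + 1) = z i - \<alpha> *\<^sub>R g i (z i)"
    and bound: "\<And>i. i \<in> {1..m} \<Longrightarrow> norm (g i (z i)) \<le> G"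
    and lip: "\<And>i. i \<in> {1..m} \<Longrightarrow> norm (g i (z 1) - g i (z i)) \<le> \<Lambda> i * norm (z 1 - z i)"
    and nonneg: "\<And>i. i \<in> {1..m} \<Longrightarrow> 0 \<le> \<Lambda> i" "0 \<le> \<alpha>" "0 \<le> G"
  obtains e where "z (m + 1) = z 1 - \<alpha> *\<^sub>R ((\<Sum>i=1..m. g i (z 1)) - e)"
    and "norm e \<le> \<alpha> * (sum \<Lambda> {1..m} * G * real m)"
proof
  let ?e = "\<Sum>i=1..m. g i (z 1) - g i (z i)"
  have z: "z (i + 1) = z 1 - \<alpha> *\<^sub>R (\<Sum>j=1..i. g j (z j))" if "i \<le> m" for i
    using that
  proof (induction i)
    case (Suc i)
    then show ?case
      using step[of "Suc i"] by (simp add: scaleR_add_right diff_diff_eq)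
  qed simp
  show "z (m + 1) = z 1 - \<alpha> *\<^sub>R ((\<Sum>i=1..m. g i (z 1)) - ?e)"
    using z[of m] by (simp add: sum_subtractf)
  have drift: "norm (z 1 - z i) \<le> \<alpha> * (G * real m)" if i: "i \<in> {1..m}" for i
  proof -
    have "norm (g j (z j)) \<le> G" if "j \<in> {1..i-1}" for j
      using bound[of j] that i by auto
    then have "norm (\<Sum>j=1..i-1. g j (z j)) \<le> real (i - 1) * G"
      using sum_norm_bound[of "{1..i-1}" "\<lambda>j. g j (z j)" G] by simp
    also have "\<dots> \<le> G * real m"
      using i nonneg(3) by (subst mult.commute) (intro mult_left_mono, auto)
    finally have "\<alpha> * norm (\<Sum>j=1..i-1. g j (z j)) \<le> \<alpha> * (G * real m)"
      using nonneg(2) by (rule mult_left_mono)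
    moreover have "z 1 - z i = \<alpha> *\<^sub>R (\<Sum>j=1..i-1. g j (z j))"
      using z[of "i - 1"] i by auto
    ultimately show ?thesis
      using nonneg(2) by simp
  qed
  have "norm ?e \<le> (\<Sum>i=1..m. \<Lambda> i * (\<alpha> * (G * real m)))"
    using lip drift nonneg(1) by (intro sum_norm_le) (meson mult_left_mono order_trans)
  also have "\<dots> = \<alpha> * (sum \<Lambda> {1..m} * G * real m)"
    by (simp add: sum_distrib_left sum_distrib_right mult_ac)
  finally show "norm ?e \<le> \<alpha> * (sum \<Lambda> {1..m} * G * real m)" .
qed

text \<open>Smoothness enters only through the gradients at the two endpoints \<open>x\<close> and \<open>y\<close> of the step, so
  the minimizer may lie in a region where the gradient has no known Lipschitz constant. The term
  \<open>\<parallel>x - y\<parallel>\<^sup>2\<close> that the step length produces with the sign \<open>-1\<close> absorbs the Lipschitz term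
  \<open>2 \<alpha> L \<parallel>x - y\<parallel>\<^sup>2\<close>; this is where \<open>\<alpha> L \<le> 1/2\<close> comes from.\<close>

lemma inexact_gradient_step:
  assumes sc: "strongly_convex c F"
    and min: "is_arg_min F (\<lambda>_. True) xs" "GDERIV F xs :> D"
    and der: "GDERIV F x :> g" "GDERIV F y :> h"
    and y: "y = x - \<alpha> *\<^sub>R (g - e)"
    and e: "norm e \<le> \<alpha> * M"
    and lip: "norm (h - g) \<le> L * norm (y - x)"
    and \<alpha>: "0 < \<alpha>" "\<alpha> * L \<le> 1/2"
  shows "(1 + \<alpha> * c) * (norm (y - xs))\<^sup>2
    \<le> (1 - \<alpha> * c) * (norm (x - xs))\<^sup>2 + 2 * \<alpha>\<^sup>2 * M * norm (y - xs)"
proof -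
  have "F xs + c / 2 * (norm (y - xs))\<^sup>2 \<le> F y"
    using sc min by (rule strongly_convex_quadratic_growth)
  moreover have "F x + (xs - x) \<bullet> g + c / 2 * (norm (xs - x))\<^sup>2 \<le> F xs"
    using sc der(1) by (rule strongly_convex_ge_tangent)
  moreover have "F y + (x - y) \<bullet> h + c / 2 * (norm (x - y))\<^sup>2 \<le> F x"
    using sc der(2) by (rule strongly_convex_ge_tangent)
  moreover have "0 \<le> c / 2 * (norm (x - y))\<^sup>2"
    using sc by (simp add: strongly_convex_def)
  ultimately have "c / 2 * ((norm (y - xs))\<^sup>2 + (norm (x - xs))\<^sup>2) \<le> (x - xs) \<bullet> g - (x - y) \<bullet> h"
    by (simp add: norm_minus_commute inner_diff_left algebra_simps)
  also have "\<dots> = (y - xs) \<bullet> g + (y - x) \<bullet> (h - g)"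
    by (simp add: inner_simps)
  also have "(y - x) \<bullet> (h - g) \<le> L * (norm (y - x))\<^sup>2"
  proof -
    have "(y - x) \<bullet> (h - g) \<le> norm (y - x) * norm (h - g)"
      by (rule norm_cauchy_schwarz)
    also have "\<dots> \<le> norm (y - x) * (L * norm (y - x))"
      using lip by (intro mult_left_mono) auto
    finally show ?thesis
      by (simp add: power2_eq_square mult_ac)
  qed
  finally have "c / 2 * ((norm (y - xs))\<^sup>2 + (norm (x - xs))\<^sup>2)
      \<le> (y - xs) \<bullet> g + L * (norm (y - x))\<^sup>2"
    by simp
  then have "2 * \<alpha> * (c / 2 * ((norm (y - xs))\<^sup>2 + (norm (x - xs))\<^sup>2))
      \<le> 2 * \<alpha> * ((y - xs) \<bullet> g + L * (norm (y - x))\<^sup>2)"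
    using \<alpha>(1) by (intro mult_left_mono) auto
  moreover have "2 * \<alpha> * ((y - xs) \<bullet> g)
      = (norm (x - xs))\<^sup>2 - (norm (y - xs))\<^sup>2 - (norm (y - x))\<^sup>2 + 2 * \<alpha> * ((y - xs) \<bullet> e)"
  proof -
    have "\<alpha> *\<^sub>R g = x - y + \<alpha> *\<^sub>R e"
      using y by (simp add: algebra_simps)
    then have "\<alpha> * ((y - xs) \<bullet> g) = (y - xs) \<bullet> (x - y) + \<alpha> * ((y - xs) \<bullet> e)"
      by (metis inner_add_right inner_scaleR_right)
    then show ?thesis
      by (simp add: power2_norm_eq_inner inner_simps inner_commute)
  qed
  moreover have "2 * \<alpha> * (L * (norm (y - x))\<^sup>2) \<le> (norm (y - x))\<^sup>2"
    using mult_right_mono[OF \<alpha>(2), of "(norm (y - x))\<^sup>2"] by (simp add: mult_ac)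
  moreover have "2 * \<alpha> * ((y - xs) \<bullet> e) \<le> 2 * \<alpha>\<^sup>2 * M * norm (y - xs)"
  proof -
    have "(y - xs) \<bullet> e \<le> norm (y - xs) * norm e"
      by (rule norm_cauchy_schwarz)
    also have "\<dots> \<le> norm (y - xs) * (\<alpha> * M)"
      using e by (intro mult_left_mono) auto
    finally have "2 * \<alpha> * ((y - xs) \<bullet> e) \<le> 2 * \<alpha> * (norm (y - xs) * (\<alpha> * M))"
      using \<alpha>(1) by (intro mult_left_mono) auto
    then show ?thesis
      by (simp add: power2_eq_square mult_ac)
  qed
  ultimately show ?thesis
    by (simp add: algebra_simps)
qed

section \<open>Counting cycles\<close>

lemma contraction_with_error_power:
  fixes b :: "nat \<Rightarrow> real"
  assumes "\<And>k. b (Suc k) \<le> (1 - t) * b k + t * s" "t \<le> 1" "0 \<le> s"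
  shows "b k \<le> (1 - t) ^ k * b 0 + s"
proof (induction k)
  case (Suc k)
  have "b (Suc k) \<le> (1 - t) * ((1 - t) ^ k * b 0 + s) + t * s"
    using assms(1)[of k] mult_left_mono[OF Suc, of "1 - t"] assms(2) by linarith
  then show ?case
    by (simp add: algebra_simps)
qed (use assms in simp)

text \<open>The limiting level \<open>\<epsilon>\<^sup>2/4\<close> leaves room: it is enough to bring the transient part down to
  \<open>\<epsilon>\<^sup>2/2\<close>.\<close>

lemma contraction_with_error_le:
  fixes a :: "nat \<Rightarrow> real"
  assumes rec: "\<And>k. (a (Suc k))\<^sup>2 \<le> (1 - t) * (a k)\<^sup>2 + t * (\<epsilon>\<^sup>2 / 4)"
    and t: "t \<le> 1" and \<epsilon>: "0 < \<epsilon>" and k: "ln (2 * (a 0)\<^sup>2 / \<epsilon>\<^sup>2) \<le> t * real k"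
  shows "a k \<le> \<epsilon>"
proof -
  have "(1 - t) ^ k \<le> exp (- t) ^ k"
    using t exp_ge_add_one_self[of "- t"] by (intro power_mono) auto
  also have "\<dots> = exp (- (t * real k))"
    by (simp add: exp_of_nat_mult[symmetric] mult.commute)
  finally have "(1 - t) ^ k * (a 0)\<^sup>2 \<le> exp (- (t * real k)) * (a 0)\<^sup>2"
    by (rule mult_right_mono) simp
  also have "\<dots> \<le> \<epsilon>\<^sup>2 / 2"
  proof (cases "a 0 = 0")
    case False
    then have pos: "0 < 2 * (a 0)\<^sup>2 / \<epsilon>\<^sup>2"
      using \<epsilon> by simp
    have "2 * (a 0)\<^sup>2 / \<epsilon>\<^sup>2 \<le> exp (t * real k)"
      using k pos by (metis exp_le_cancel_iff exp_ln)
    then show ?thesis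
      using \<epsilon> by (simp add: exp_minus field_simps)
  qed simp
  finally have "(a k)\<^sup>2 \<le> \<epsilon>\<^sup>2 / 2 + \<epsilon>\<^sup>2 / 4"
    using contraction_with_error_power[of "\<lambda>k. (a k)\<^sup>2" t "\<epsilon>\<^sup>2 / 4" k] rec t by simp
  also have "\<dots> \<le> \<epsilon>\<^sup>2"
    by simp
  finally show ?thesis
    by (rule power2_le_imp_le) (use \<epsilon> in simp)
qed

text \<open>The threshold for \<open>\<epsilon>\<close> does two things. Below \<open>1 / (2 R\<^sup>2 + 1)\<close> the initial distance costs only a
  third factor: \<open>2 (a 0)\<^sup>2/\<epsilon>\<^sup>2 \<le> 1/\<epsilon>\<^sup>3\<close>. Below \<open>exp (- 1)\<close> one has \<open>1 \<le> ln (1/\<epsilon>) / t\<close>, which pays for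
  rounding up to an integer.\<close>

lemma contraction_with_error_count:
  fixes a :: "nat \<Rightarrow> real"
  assumes rec: "\<And>k. (a (Suc k))\<^sup>2 \<le> (1 - t) * (a k)\<^sup>2 + t * (\<epsilon>\<^sup>2 / 4)"
    and t: "0 < t" "t \<le> 1" and \<epsilon>: "0 < \<epsilon>" and nonneg: "0 \<le> a 0"
  shows "\<exists>N. (\<forall>k\<ge>N. a k \<le> \<epsilon>) \<and>
    (a 0 \<le> R \<and> \<epsilon> < min (exp (- 1)) (1 / (2 * R\<^sup>2 + 1)) \<longrightarrow> real N \<le> 4 * ln (1 / \<epsilon>) / t)"
proof -
  let ?l = "max 0 (ln (2 * (a 0)\<^sup>2 / \<epsilon>\<^sup>2))"
  let ?N = "nat \<lceil>?l / t\<rceil>"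
  have "a k \<le> \<epsilon>" if "?N \<le> k" for k
  proof (rule contraction_with_error_le[of a, OF rec t(2) \<epsilon>])
    have "?l / t \<le> real ?N"
      by linarith
    also have "\<dots> \<le> real k"
      using that by simp
    finally show "ln (2 * (a 0)\<^sup>2 / \<epsilon>\<^sup>2) \<le> t * real k"
      using t(1) by (simp add: field_simps)
  qed
  moreover have "real ?N \<le> 4 * ln (1 / \<epsilon>) / t"
    if R: "a 0 \<le> R" and small: "\<epsilon> < min (exp (- 1)) (1 / (2 * R\<^sup>2 + 1))"
  proof -
    have "ln \<epsilon> \<le> - 1"
      using small \<epsilon> by (metis exp_gt_zero less_imp_le ln_exp ln_le_cancel_iff min_less_iff_conj)
    then have ln: "1 \<le> ln (1 / \<epsilon>)"
      using \<epsilon> by (simp add: ln_div)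
    have "?l \<le> 3 * ln (1 / \<epsilon>)"
    proof (cases "a 0 = 0")
      case False
      have "2 * R\<^sup>2 + 1 > 0"
        by (simp add: add_nonneg_pos)
      then have "\<epsilon> * (2 * R\<^sup>2 + 1) < 1"
        using small by (simp add: field_simps)
      moreover have "(a 0)\<^sup>2 \<le> R\<^sup>2"
        using R nonneg by (rule power_mono)
      then have "\<epsilon> * (2 * (a 0)\<^sup>2) \<le> \<epsilon> * (2 * R\<^sup>2 + 1)"
        using \<epsilon> by (intro mult_left_mono) auto
      ultimately have "\<epsilon> * (2 * (a 0)\<^sup>2) \<le> 1"
        by linarith
      then have "2 * (a 0)\<^sup>2 / \<epsilon>\<^sup>2 \<le> (1 / \<epsilon>) ^ 3"
        using \<epsilon> by (simp add: field_simps power2_eq_square power3_eq_cube)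
      then have "ln (2 * (a 0)\<^sup>2 / \<epsilon>\<^sup>2) \<le> ln ((1 / \<epsilon>) ^ 3)"
        using False \<epsilon> by (subst ln_le_cancel_iff) auto
      also have "\<dots> = 3 * ln (1 / \<epsilon>)"
        using \<epsilon> by (subst ln_realpow) auto
      finally show ?thesis
        using ln by simp
    qed (use ln in simp)
    then have "?l / t \<le> 3 * ln (1 / \<epsilon>) / t"
      using t(1) by (intro divide_right_mono) auto
    moreover have "1 \<le> ln (1 / \<epsilon>) / t"
      using ln t by simp
    moreover have "real ?N \<le> ?l / t + 1"
    proof -
      have "0 \<le> ?l / t"
        using t(1) by simp
      then show ?thesis
        by linarith
    qed
    ultimately show ?thesis
      by (simp add: add_divide_distrib[symmetric])
  qed
  ultimately show ?thesis
    by (intro exI[of _ ?N] conjI allI impI) (assumption | elim conjE)+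
qed

section \<open>The complexity bound\<close>

text \<open>The constant 8 is the 4 from counting cycles times the 2 in \<open>1/t = 2 M / (c\<^sup>2 \<epsilon>)\<close>. The bound
  \<open>\<epsilon> < 2 M / c\<^sup>2\<close> says \<open>t < 1\<close>, and it forces \<open>M > 0\<close>. A large step, \<open>\<alpha> L > 1/2\<close>, can
  make gradient steps oscillate for ever; it also makes \<open>\<epsilon>\<close> so large that all of \<open>X\<close> is within
  \<open>\<epsilon>\<close> of the minimizer.\<close>

lemma IG_complexity:
  fixes f :: "nat \<Rightarrow> real^'n \<Rightarrow> real"
  assumes m: "1 \<le> m"
    and f: "\<And>i. i \<in> {1..m} \<Longrightarrow> twice_continuously_differentiable (f i)"
    and F: "F = (\<lambda>y. \<Sum>i=1..m. f i y)"
    and sc: "strongly_convex c F"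
    and min: "is_arg_min F (\<lambda>_. True) xs"
    and X: "compact X" "convex X"
    and G: "\<And>i z. i \<in> {1..m} \<Longrightarrow> z \<in> X \<Longrightarrow> norm (grad (f i) z) \<le> G"
    and L: "L = (\<Sum>i=1..m. hessian_bound (f i) X)"
    and M: "M = L * G * real m"
    and \<epsilon>: "0 < \<epsilon>" "\<epsilon> < 2 * M / c\<^sup>2"
    and \<alpha>: "\<alpha> = \<epsilon> * c / (2 * M)"
    and IG: "IG_iterates m f \<alpha> x"
    and inX: "\<And>k i. 1 \<le> k \<Longrightarrow> i \<in> {1..m} \<Longrightarrow> x k i \<in> X"
  shows "\<exists>N::nat. (\<forall>k>N. norm (x k 1 - xs) \<le> \<epsilon>) \<and>
    (norm (x 1 1 - xs) \<le> R \<and> \<epsilon> < min (exp (- 1)) (1 / (2 * R\<^sup>2 + 1)) \<longrightarrow>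
      real N \<le> 8 * (M / c\<^sup>2 * (ln (1 / \<epsilon>) / \<epsilon>)))"
proof -
  have c: "0 < c"
    using sc by (simp add: strongly_convex_def)
  have Mpos: "0 < M"
  proof -
    have "0 < 2 * M / c\<^sup>2"
      using \<epsilon> by linarith
    then show ?thesis
      using c by (simp add: zero_less_divide_iff)
  qed
  have \<alpha>pos: "0 < \<alpha>"
    using \<alpha> \<epsilon>(1) c Mpos by simp
  have start: "x k 1 \<in> X" if "1 \<le> k" for k
    using inX[OF that, of 1] m by simp
  have nonempty: "X \<noteq> {}"
    using start[of 1] by auto
  have Gnn: "0 \<le> G"
    using G[of 1 "x 1 1"] m start[of 1] by (smt (verit) atLeastAtMost_iff norm_ge_zero order_refl)
  have Hnn: "0 \<le> hessian_bound (f i) X" if "i \<in> {1..m}" for i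
    using f[OF that] X(1) nonempty continuous_on_subset
    by (intro hessian_bound_nonneg) (auto simp: twice_continuously_differentiable_def)
  define g where "g = (\<lambda>z. \<Sum>i=1..m. grad (f i) z)"
  have der: "GDERIV F z :> g z" for z
    unfolding F g_def using f
    by (intro GDERIV_sum GDERIV_grad) (auto simp: twice_continuously_differentiable_def)
  show ?thesis
  proof (cases "\<alpha> * L \<le> 1/2")
    case True
    define t where "t = \<alpha> * c"
    have t: "t = \<epsilon> * c\<^sup>2 / (2 * M)"
      by (simp add: t_def \<alpha> power2_eq_square)
    have t01: "0 < t" "t \<le> 1"
      using \<epsilon> c Mpos by (auto simp: t field_simps)
    have err: "2 * \<alpha>\<^sup>2 * M = t * \<epsilon>"
      using Mpos by (simp add: t_def \<alpha> power2_eq_square)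
    have rec: "(norm (x (k + 1) 1 - xs))\<^sup>2 \<le> (1 - t) * (norm (x k 1 - xs))\<^sup>2 + t * (\<epsilon>\<^sup>2 / 4)"
      if k: "1 \<le> k" for k
    proof -
      obtain e where e: "x k (m + 1) = x k 1 - \<alpha> *\<^sub>R ((\<Sum>i=1..m. grad (f i) (x k 1)) - e)"
          "norm e \<le> \<alpha> * ((\<Sum>i=1..m. hessian_bound (f i) X) * G * real m)"
      proof (rule cycle_as_inexact_step[where z = "x k" and g = "\<lambda>i. grad (f i)"])
        show "x k (i + 1) = x k i - \<alpha> *\<^sub>R grad (f i) (x k i)" if "i \<in> {1..m}" for i
          using IG k that by (auto simp: IG_iterates_def)
        show "norm (grad (f i) (x k i)) \<le> G" if "i \<in> {1..m}" for i
          using G inX k that by blast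
        show "norm (grad (f i) (x k 1) - grad (f i) (x k i))
            \<le> hessian_bound (f i) X * norm (x k 1 - x k i)" if "i \<in> {1..m}" for i
          using f X start inX k that by (intro grad_lipschitz) auto
        show "0 \<le> hessian_bound (f i) X" if "i \<in> {1..m}" for i
          using that by (rule Hnn)
        show "0 \<le> \<alpha>"
          using \<alpha>pos by simp
        show "0 \<le> G"
          by (rule Gnn)
      qed blast
      have glue: "x (k + 1) 1 = x k (m + 1)"
        using IG k by (auto simp: IG_iterates_def)
      have "norm (g (x (k + 1) 1) - g (x k 1))
          \<le> (\<Sum>i=1..m. hessian_bound (f i) X * norm (x (k + 1) 1 - x k 1))"
        unfolding g_def sum_subtractf[symmetric]
        using f X start k by (intro sum_norm_le grad_lipschitz) auto
      then have lip: "norm (g (x (k + 1) 1) - g (x k 1)) \<le> L * norm (x (k + 1) 1 - x k 1)"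
        by (simp add: L sum_distrib_right)
      have "(1 + \<alpha> * c) * (norm (x (k + 1) 1 - xs))\<^sup>2
          \<le> (1 - \<alpha> * c) * (norm (x k 1 - xs))\<^sup>2 + 2 * \<alpha>\<^sup>2 * M * norm (x (k + 1) 1 - xs)"
      proof (rule inexact_gradient_step[OF sc min der der der _ _ lip \<alpha>pos True])
        show "x (k + 1) 1 = x k 1 - \<alpha> *\<^sub>R (g (x k 1) - e)"
          unfolding glue g_def by (rule e(1))
        show "norm e \<le> \<alpha> * M"
          unfolding M L by (rule e(2))
      qed
      moreover have "t * \<epsilon> * norm (x (k + 1) 1 - xs)
          \<le> t * ((norm (x (k + 1) 1 - xs))\<^sup>2 + \<epsilon>\<^sup>2 / 4)"
      proof -
        \<comment> \<open>The square is taken at the fixed point \<open>\<epsilon>/2\<close> of the recursion.\<close>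
        have "0 \<le> (norm (x (k + 1) 1 - xs) - \<epsilon> / 2)\<^sup>2"
          by simp
        then have "\<epsilon> * norm (x (k + 1) 1 - xs) \<le> (norm (x (k + 1) 1 - xs))\<^sup>2 + \<epsilon>\<^sup>2 / 4"
          by (simp add: power2_eq_square algebra_simps)
        then show ?thesis
          unfolding mult.assoc using t01(1) by (intro mult_left_mono) auto
      qed
      ultimately show ?thesis
        unfolding err t_def[symmetric] by (simp add: algebra_simps)
    qed
    \<comment> \<open>Cycles are counted from 1, so after \<open>k\<close> cycles the distance is \<open>a k\<close>.\<close>
    define a where "a = (\<lambda>k. norm (x (k + 1) 1 - xs))"
    have arec: "(a (Suc k))\<^sup>2 \<le> (1 - t) * (a k)\<^sup>2 + t * (\<epsilon>\<^sup>2 / 4)" for k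
      using rec[of "k + 1"] by (simp add: a_def)
    have a0: "0 \<le> a 0"
      by (simp add: a_def)
    obtain N where N: "\<forall>k\<ge>N. a k \<le> \<epsilon>"
      "a 0 \<le> R \<and> \<epsilon> < min (exp (- 1)) (1 / (2 * R\<^sup>2 + 1)) \<longrightarrow> real N \<le> 4 * ln (1 / \<epsilon>) / t"
      using contraction_with_error_count[of a t \<epsilon> R, OF arec t01 \<epsilon>(1) a0]
      by (elim exE conjE)
    have bound: "4 * ln (1 / \<epsilon>) / t = 8 * (M / c\<^sup>2 * (ln (1 / \<epsilon>) / \<epsilon>))"
      using \<epsilon>(1) c Mpos by (simp add: t field_simps)
    show ?thesis
    proof (rule exI[of _ N], intro conjI allI impI)
      fix k assume "N < k"
      then have "N \<le> k - 1" "k - 1 + 1 = k"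
        by simp_all
      then show "norm (x k 1 - xs) \<le> \<epsilon>"
        using N(1) unfolding a_def by metis
    next
      assume "norm (x 1 1 - xs) \<le> R \<and> \<epsilon> < min (exp (- 1)) (1 / (2 * R\<^sup>2 + 1))"
      then show "real N \<le> 8 * (M / c\<^sup>2 * (ln (1 / \<epsilon>) / \<epsilon>))"
        using N(2) unfolding bound a_def by (simp only: add_0)
    qed
  next
    case False
    have "1 * (G * real m) \<le> 2 * (\<alpha> * L) * (G * real m)"
      using False Gnn by (intro mult_right_mono) auto
    moreover have "2 * (\<alpha> * L) * (G * real m) = 2 * \<alpha> * M"
      unfolding M by (simp only: mult_ac)
    moreover have "2 * \<alpha> * M = c * \<epsilon>"
      using Mpos by (simp add: \<alpha> field_simps)
    ultimately have large: "G * real m \<le> c * \<epsilon>"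
      by linarith
    have near: "norm (z - xs) \<le> \<epsilon>" if "z \<in> X" for z
    proof -
      have "c * norm (z - xs) \<le> norm (g z)"
        by (rule strongly_convex_dist_arg_min_le[OF sc min der der])
      moreover have "norm (g z) \<le> (\<Sum>i=1..m. G)"
        unfolding g_def using G that by (intro sum_norm_le) auto
      moreover have "(\<Sum>i=1..m. G) = G * real m"
        by simp
      ultimately have "c * norm (z - xs) \<le> c * \<epsilon>"
        using large by linarith
      then show ?thesis
        using c by (rule mult_left_le_imp_le)
    qed
    show ?thesis
    proof (rule exI[of _ 0], intro conjI allI impI)
      fix k :: nat assume "0 < k"
      then show "norm (x k 1 - xs) \<le> \<epsilon>"
        using near start by simp
    next
      assume "norm (x 1 1 - xs) \<le> R \<and> \<epsilon> < min (exp (- 1)) (1 / (2 * R\<^sup>2 + 1))"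
      then have "\<epsilon> < exp (- 1)"
        by simp
      also have "\<dots> \<le> 1"
        by simp
      finally have "0 \<le> ln (1 / \<epsilon>)"
        using \<epsilon>(1) by simp
      then show "real 0 \<le> 8 * (M / c\<^sup>2 * (ln (1 / \<epsilon>) / \<epsilon>))"
        using \<epsilon>(1) Mpos by simp
    qed
  qed
qed

theorem corollary3p3:
  shows "\<exists>C>0. \<forall>R. \<exists>\<epsilon>\<^sub>0>0.
    \<forall>(m::nat) (f :: nat \<Rightarrow> real^'n \<Rightarrow> real) F c xs X ctr r G L M \<epsilon> \<alpha> x.
      1 \<le> m \<and>
      (\<forall>i\<in>{1..m}. convex_on UNIV (f i) \<and> twice_continuously_differentiable (f i)) \<and>
      F = (\<lambda>y. \<Sum>i=1..m. f i y) \<and>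
      strongly_convex c F \<and>
      is_arg_min F (\<lambda>_. True) xs \<and>
      0 \<le> r \<and> X = cball ctr r \<and>
      (\<forall>i\<in>{1..m}. \<forall>z\<in>X. norm (grad (f i) z) \<le> G) \<and>
      L = (\<Sum>i=1..m. hessian_bound (f i) X) \<and>
      M = L * G * real m \<and>
      0 < \<epsilon> \<and> \<epsilon> < 2 * M / c\<^sup>2 \<and>
      \<alpha> = \<epsilon> * c / (2 * M) \<and>
      IG_iterates m f \<alpha> x \<and>
      (\<forall>k\<ge>1. \<forall>i\<in>{1..m}. x k i \<in> X)
      \<longrightarrow>
      (\<exists>N::nat. (\<forall>k>N. norm (x k 1 - xs) \<le> \<epsilon>) \<and>
        (norm (x 1 1 - xs) \<le> R \<and> \<epsilon> < \<epsilon>\<^sub>0 \<longrightarrow>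
          real N \<le> C * (M / c\<^sup>2 * (ln (1 / \<epsilon>) / \<epsilon>))))"
  apply (rule exI[of _ "8::real"], rule conjI, simp, rule allI)
  subgoal for R
    apply (rule exI[of _ "min (exp (- 1)) (1 / (2 * R\<^sup>2 + 1))"], rule conjI)
    subgoal
      by (simp add: add_nonneg_pos)
    apply (intro allI impI, elim conjE)
    subgoal premises hyps for m f F c xs X ctr r G L M \<epsilon> \<alpha> x
    proof (rule IG_complexity[OF hyps(1) _ hyps(3,4,5) _ _ _ hyps(9-14)])
      show "twice_continuously_differentiable (f i)" if "i \<in> {1..m}" for i
        using hyps(2) that by blast
      show "compact X" "convex X"
        unfolding hyps(7) by simp_all
      show "norm (grad (f i) z) \<le> G" if "i \<in> {1..m}" "z \<in> X" for i z
        using hyps(8) that by blast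
      show "x k i \<in> X" if "1 \<le> k" "i \<in> {1..m}" for k i
        using hyps(15) that by blast
    qed
    done
  done

end
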